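(* There are absolute constants implicit in the $O(\cdot)$ terms such that for all integers $t,k$ with $3\leq t\leq k^{1/2}$: \[ \mathrm{LCS}_2(t,\mathcal{P}_k)\leq 4k^{1/3}+O(k^{7/40})\quad\text{if } t\leq k^{1/3}, \] \[ \mathrm{LCS}_2(t,\mathcal{P}_k)\leq 4t+O(t^{21/40})\quad\text{if } k^{1/3}\leq t\leq k^{1/2}. \]
   Context: $\mathcal{P}_k$ is the set of permutations on $k$ letters, viewed as words over $\{1,\dots,k\}$ in which each letter occurs exactly once. For words $w,w'$, $\mathrm{LCS}(w,w')$ is the length of a longest common subsequence (a word that is a subsequence, letters in order but not necessarily consecutive, of both). For a set $\mathcal{W}$ of words, $\mathrm{LCS}(\mathcal W)$ is the length of a longest word that is a subsequence of every word in $\mathcal W$; $\mathrm{LCS}_T(\mathcal W)=\max\mathrm{LCS}(\mathcal W')$ over subsets $\mathcal W'\subset\mathcal W$ of size $T$; and for a family $\mathcal F$ of words, $\mathrm{LCS}_T(t,\mathcal F)=\min\mathrm{LCS}_T(\mathcal W)$ over all $t$-element subsets $\mathcal W\subset\mathcal F$. Thus $\mathrm{LCS}_2(t,\mathcal P_k)$ is the minimum, over sets of $t$ distinct permutations in $\mathcal P_k$, of the maximum LCS of two distinct members of the set. *)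

theory Defs
  imports "HOL-Analysis.Analysis" "HOL-Library.Sublist"
begin

definition perms :: "nat \<Rightarrow> nat list set" where
  "perms k = {w. distinct w \<and> set w = {1..k}}"

definition lcs :: "'a list \<Rightarrow> 'a list \<Rightarrow> nat" where
  "lcs w w' = Max {length z | z. subseq z w \<and> subseq z w'}"

definition lcs_set :: "'a list set \<Rightarrow> nat" where
  "lcs_set W = Max {length z | z. \<forall>w\<in>W. subseq z w}"

definition lcsT :: "nat \<Rightarrow> 'a list set \<Rightarrow> nat" where
  "lcsT T W = Max {lcs_set W' | W'. W' \<subseteq> W \<and> card W' = T}"

definition lcsT_fam :: "nat \<Rightarrow> nat \<Rightarrow> 'a list set \<Rightarrow> nat" where
  "lcsT_fam T t F = Min {lcsT T W | W. W \<subseteq> F \<and> card W = t}"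

end

theory Submission
  imports Defs "HOL-Number_Theory.Number_Theory" "HOL-Combinatorics.Multiset_Permutations"
    "HOL-Real_Asymp.Real_Asymp"
begin

text \<open>
  For a prime p, order the points (x, y, z) of the cube of the field with p elements, for each
  i < p, lexicographically by the pair of residues a = x + iy + i^2 z and b = y + 2iz.
  For i and j distinct, the sum b + b' of the second residues is h(a - a') modulo p, with h(i - j) = 2, so the
  two orders run through each intersection of a plane of constant a with one of constant a' in
  opposite directions, up to a cyclic shift.
  If 0 \<le> h < p, then (pa + b) + (pa' + b') + (p - h)a + ha' is a multiple of p below
  p(3p - 1) that increases strictly along every common subsequence. Hence common subsequences
  have length less than 3p.

  Since 3 < 4, no strong theorem on gaps between primes is needed: it suffices that there is a prime
  between n and 4n/3 for all large n. Chebyshev's method gives such a prime, because its upper and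
  lower bounds for psi differ by a factor close to 6/5 only.
\<close>

subsection \<open>Primes between n and 4n/3\<close>

definition psi :: "nat \<Rightarrow> real" where
  "psi n = (\<Sum>m=1..n. mangoldt m)"

lemma psi_mono: "m \<le> n \<Longrightarrow> psi m \<le> psi n"
  unfolding psi_def by (rule sum_mono2) (auto simp: mangoldt_nonneg)

lemma ln_fact_Suc: "ln (fact (Suc n) :: real) = ln (real (Suc n)) + ln (fact n)"
  unfolding fact_Suc by (subst ln_mult_pos) auto

text \<open>Legendre's formula: from n to n + 1 the quotient by m grows by one exactly when m
  divides n + 1, and \<open>mangoldt\<close> summed over these divisors is ln (n + 1).\<close>

lemma ln_fact_eq_sum_mangoldt:
  "ln (fact n) = (\<Sum>m=1..n. mangoldt m * real (n div m))"
proof (induction n)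
  case 0
  show ?case by simp
next
  case (Suc n)
  have "(\<Sum>m=1..Suc n. mangoldt m * real (Suc n div m)) =
      (\<Sum>m=1..Suc n. mangoldt m * real (n div m) + (if m dvd Suc n then mangoldt m else 0))"
    by (intro sum.cong) (auto simp: div_Suc dvd_eq_mod_eq_0 algebra_simps)
  also have "\<dots> = (\<Sum>m=1..n. mangoldt m * real (n div m))
      + (\<Sum>m=1..Suc n. if m dvd Suc n then mangoldt m else 0)"
    by (simp add: sum.distrib)
  also have "(\<Sum>m=1..Suc n. if m dvd Suc n then mangoldt m else 0) = (\<Sum>m | m dvd Suc n. mangoldt m)"
    by (rule sum.mono_neutral_cong_right)
       (auto simp: Suc_le_eq intro: dvd_pos_nat dvd_imp_le)
  also have "\<dots> = ln (real (Suc n))"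
    using mangoldt_sum[of "Suc n", where 'a = real] by simp
  finally show ?case
    using Suc by (simp add: ln_fact_Suc del: fact_Suc)
qed

text \<open>Terms with m > n div d vanish and the two divisions commute. Factorials for different d
  thus become sums over one range, with weights depending only on n div m.\<close>

lemma ln_fact_div_eq_sum_mangoldt:
  "ln (fact (n div d)) = (\<Sum>m=1..n. mangoldt m * real (n div m div d))"
proof -
  have "ln (fact (n div d)) = (\<Sum>m=1..n div d. mangoldt m * real (n div d div m))"
    by (rule ln_fact_eq_sum_mangoldt)
  also have "\<dots> = (\<Sum>m=1..n. mangoldt m * real (n div d div m))"
    by (rule sum.mono_neutral_left) auto
  also have "\<dots> = (\<Sum>m=1..n. mangoldt m * real (n div m div d))"
    by (simp add: div_mult2_eq [symmetric] mult.commute)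
  finally show ?thesis .
qed

lemma ln_fact_ge: "real n * ln n - n \<le> ln (fact n)"
proof (induction n)
  case 0
  show ?case by simp
next
  case (Suc n)
  show ?case
  proof (cases "n = 0")
    case False
    have "ln (real (Suc n)) - ln n = ln (1 + 1 / n)"
      using False by (subst ln_divide_pos [symmetric]) (auto simp: add_divide_distrib add.commute)
    also have "\<dots> \<le> 1 / n"
      using False by (intro ln_add_one_self_le_self) auto
    finally have "n * (ln (real (Suc n)) - ln n) \<le> 1"
      using False by (simp add: field_simps)
    with Suc show ?thesis
      by (simp add: ln_fact_Suc algebra_simps del: fact_Suc)
  qed simp
qed

text \<open>The upper half of an elementary Stirling estimate; the induction step is ln x \<le> x -
  1 at x = n / (n + 1).\<close>

lemma ln_fact_le: "n \<ge> 1 \<Longrightarrow> ln (fact n) \<le> real n * ln n - n + ln n + 1"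
proof (induction n rule: nat_induct_at_least)
  case base
  show ?case by simp
next
  case (Suc n)
  have "ln (real n) - ln (Suc n) = ln (real n / Suc n)"
    using Suc by (subst ln_div) auto
  also have "\<dots> \<le> real n / Suc n - 1"
    using Suc by (intro ln_le_minus_one) auto
  finally have "Suc n * (ln (real n) - ln (Suc n)) \<le> -1"
    by (simp add: field_simps)
  with Suc show ?case
    by (simp add: ln_fact_Suc algebra_simps del: fact_Suc)
qed

lemma x_ln_x_minus_x_mono:
  fixes x y :: real
  assumes "1 \<le> x" "x \<le> y"
  shows "x * ln x - x \<le> y * ln y - y"
proof (rule DERIV_nonneg_imp_nondecreasing[OF assms(2)])
  fix t assume "x \<le> t" "t \<le> y"
  then show "\<exists>D. ((\<lambda>x. x * ln x - x) has_real_derivative D) (at t) \<and> 0 \<le> D"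
    using assms by (intro exI[of _ "ln t"]) (auto intro!: derivative_eq_intros)
qed

text \<open>With x = n / d and q = n div d, the upper Stirling bound is applied at q \<le> x and the
  lower one at q + 1 \<ge> x; monotonicity of x ln x - x moves both to x. The shift to q + 1 costs
  ln (q + 1) \<le> ln n + 1.\<close>

lemma ln_fact_div_approx:
  assumes "1 \<le> d" "d \<le> n"
  shows "\<bar>ln (fact (n div d)) - (n / d * (ln n - ln d) - n / d)\<bar> \<le> ln n + 1"
proof -
  define q where "q = n div d"
  define x where "x = n / d"
  have q: "q \<ge> 1"
    using assms by (simp add: q_def div_greater_zero_iff Suc_le_eq)
  have qx: "real q \<le> x" "x \<le> real (Suc q)"
  proof -
    have "n < d * Suc q"
      using assms dividend_less_times_div[of d n] by (simp add: q_def)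
    then have "real n \<le> real (d * Suc q)" by linarith
    then show "x \<le> real (Suc q)"
      using assms by (simp add: x_def field_simps)
  qed (simp add: q_def x_def of_nat_div_le_of_nat)
  have lnx: "ln x = ln n - ln d"
    using assms by (simp add: x_def ln_div)
  have "q \<le> n" by (simp add: q_def)
  have "ln (fact q) \<le> q * ln q - q + ln q + 1"
    using q by (rule ln_fact_le)
  also have "q * ln q - q \<le> x * ln x - x"
    using q qx by (intro x_ln_x_minus_x_mono) auto
  also have "ln q \<le> ln n"
    using q \<open>q \<le> n\<close> by simp
  finally have up: "ln (fact q) \<le> x * ln x - x + ln n + 1" by simp
  have "x * ln x - x \<le> Suc q * ln (Suc q) - Suc q"
    using q qx by (intro x_ln_x_minus_x_mono) auto
  also have "\<dots> \<le> ln (fact (Suc q))"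
    by (rule ln_fact_ge)
  also have "\<dots> = ln (Suc q) + ln (fact q)"
    by (rule ln_fact_Suc)
  also have "ln (Suc q) \<le> ln (2 * real n)"
    using q \<open>q \<le> n\<close> by simp
  also have "\<dots> = ln 2 + ln n"
    using assms by (simp add: ln_mult)
  also have "ln 2 \<le> (1::real)"
    using ln_2_less_1 by simp
  finally have "x * ln x - x \<le> 1 + ln n + ln (fact q)" by simp
  with up show ?thesis
    unfolding q_def [symmetric] x_def [symmetric] lnx [symmetric] by simp
qed

section \<open>Chebyshev's bounds for psi\<close>

text \<open>The growth rate of \<open>cheb_sum\<close>, about 0.92. The terms n ln n and n of
  Stirling's formula cancel because 1 - 1/2 - 1/3 - 1/5 + 1/30 = 0.\<close>

definition cheb_const :: real where
  "cheb_const = ln 2 / 2 + ln 3 / 3 + ln 5 / 5 - ln 30 / 30"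

lemma cheb_const_pos: "cheb_const > 0"
proof -
  have "ln (30::real) = ln 2 + ln 3 + ln 5"
    using ln_mult[of 2 "15::real"] ln_mult[of 3 "5::real"] by simp
  then show ?thesis
    by (simp add: cheb_const_def add_pos_pos)
qed

definition cheb_sum :: "nat \<Rightarrow> real" where
  "cheb_sum n = ln (fact n) - ln (fact (n div 2)) - ln (fact (n div 3)) - ln (fact (n div 5))
     + ln (fact (n div 30))"

lemma cheb_sum_approx:
  assumes "n \<ge> 30"
  shows "\<bar>cheb_sum n - cheb_const * n\<bar> \<le> 5 * (ln n + 1)"
  using ln_fact_div_approx[of 1 n] ln_fact_div_approx[of 2 n] ln_fact_div_approx[of 3 n]
    ln_fact_div_approx[of 5 n] ln_fact_div_approx[of 30 n] assms
  by (simp add: cheb_sum_def cheb_const_def algebra_simps) (simp add: abs_le_iff field_simps)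

definition cheb_coeff :: "nat \<Rightarrow> int" where
  "cheb_coeff q = int q - int (q div 2) - int (q div 3) - int (q div 5) + int (q div 30)"

lemma cheb_sum_eq: "cheb_sum n = (\<Sum>m=1..n. mangoldt m * of_int (cheb_coeff (n div m)))"
  using ln_fact_div_eq_sum_mangoldt[of n 1] ln_fact_div_eq_sum_mangoldt[of n 2] 
    ln_fact_div_eq_sum_mangoldt[of n 3] ln_fact_div_eq_sum_mangoldt[of n 5]
    ln_fact_div_eq_sum_mangoldt[of n 30]
  unfolding cheb_sum_def
  by (simp add: cheb_coeff_def sum.distrib [symmetric] sum_subtractf [symmetric] algebra_simps
           del: One_nat_def)

text \<open>Adding 30 to q changes the value by 30 - 15 - 10 - 6 + 1 = 0, so one period of 30 values
  decides everything.\<close>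

lemma cheb_coeff_mod: "cheb_coeff q = cheb_coeff (q mod 30)"
proof -
  define a r where "a = q div 30" and "r = q mod 30"
  have q: "q = 30 * a + r" by (simp add: a_def r_def)
  have "q div 2 = 15 * a + r div 2" "q div 3 = 10 * a + r div 3" "q div 5 = 6 * a + r div 5"
    "q div 30 = a + r div 30"
    unfolding q by presburger+
  then show ?thesis
    unfolding r_def [symmetric] by (simp add: cheb_coeff_def q)
qed

lemma cheb_coeff_cases: "cheb_coeff q \<in> {0, 1}"
proof -
  have "\<forall>r\<in>set [0..<30]. cheb_coeff r \<in> {0, 1}"
    by (simp add: cheb_coeff_def upt_rec)
  then show ?thesis
    by (subst cheb_coeff_mod) simp
qed

text \<open>The coefficient first returns to 0 at q = 6, which is where the 6 in
  \<open>psi (n div 6)\<close> comes from.\<close>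

lemma cheb_coeff_eq_1: "1 \<le> q \<Longrightarrow> q < 6 \<Longrightarrow> cheb_coeff q = 1"
proof -
  assume "1 \<le> q" "q < 6"
  moreover have "\<forall>r\<in>set [1..<6]. cheb_coeff r = 1"
    by (simp add: cheb_coeff_def upt_rec)
  ultimately show ?thesis by simp
qed

lemma cheb_sum_le_psi: "cheb_sum n \<le> psi n"
  unfolding cheb_sum_eq psi_def
proof (rule sum_mono)
  fix m
  show "mangoldt m * of_int (cheb_coeff (n div m)) \<le> (mangoldt m :: real)"
    using cheb_coeff_cases[of "n div m"] mangoldt_nonneg[of m] by auto
qed

text \<open>For n div 6 < m \<le> n the quotient n div m lies between 1 and 5, so
  \<open>mangoldt m\<close> has weight 1 in \<open>cheb_sum n\<close>; all other weights are
  nonnegative.\<close>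

lemma psi_diff_le_cheb_sum: "psi n - psi (n div 6) \<le> cheb_sum n"
proof -
  have "psi n = psi (n div 6) + (\<Sum>m\<in>{n div 6<..n}. mangoldt m)"
    unfolding psi_def
    by (subst sum.union_disjoint [symmetric]) (auto intro!: sum.cong)
  also have "(\<Sum>m\<in>{n div 6<..n}. mangoldt m :: real) =
      (\<Sum>m\<in>{n div 6<..n}. mangoldt m * of_int (cheb_coeff (n div m)))"
  proof (rule sum.cong)
    fix m assume m: "m \<in> {n div 6<..n}"
    then have "1 \<le> n div m" "n div m < 6"
      by (auto simp: div_greater_zero_iff Suc_le_eq div_less_iff_less_mult mult.commute)
    then show "(mangoldt m :: real) = mangoldt m * of_int (cheb_coeff (n div m))"
      by (simp add: cheb_coeff_eq_1)
  qed simp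
  also have "\<dots> \<le> cheb_sum n"
    unfolding cheb_sum_eq
  proof (rule sum_mono2)
    fix m
    show "0 \<le> mangoldt m * (of_int (cheb_coeff (n div m)) :: real)"
      using cheb_coeff_cases[of "n div m"] mangoldt_nonneg[of m] by auto
  qed auto
  finally show ?thesis by simp
qed

lemma psi_ge: "n \<ge> 30 \<Longrightarrow> cheb_const * n - 5 * (ln n + 1) \<le> psi n"
  using cheb_sum_approx[of n] cheb_sum_le_psi[of n] by linarith

text \<open>
  Chebyshev's factor 6/5 is relaxed to 5/4 to absorb the logarithmic error terms.
\<close>

lemma psi_le: "\<exists>K. \<forall>n. psi n \<le> 5 / 4 * cheb_const * n + K"
proof -
  \<comment> \<open>The fraction 1/24 closes the induction: 1 + (5/4)/6 + 1/24 = 5/4.\<close>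
  have "\<forall>\<^sub>F n::nat in sequentially. 5 * (ln (real n) + 1) \<le> cheb_const / 24 * real n"
    using cheb_const_pos by real_asymp
  then obtain N where N: "\<And>n. n \<ge> N \<Longrightarrow> 5 * (ln (real n) + 1) \<le> cheb_const / 24 * real n"
    by (auto simp: eventually_at_top_linorder)
  \<comment> \<open>\<open>K\<close> absorbs every n up to both thresholds: \<open>N\<close> for the
    logarithmic error and 30 for \<open>cheb_sum_approx\<close>.\<close>
  define K where "K = psi (N + 30)"
  have "psi n \<le> 5 / 4 * cheb_const * n + K" for n
  proof (induction n rule: less_induct)
    case (less n)
    show ?case
    proof (cases "n \<le> N + 30")
      case True
      then show ?thesis
        using psi_mono[OF True] cheb_const_pos by (simp add: K_def add_increasing)
    next
      case False
      have "psi n \<le> psi (n div 6) + (cheb_const * n + 5 * (ln n + 1))"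
        using False psi_diff_le_cheb_sum[of n] cheb_sum_approx[of n] by auto
      also have "psi (n div 6) \<le> 5 / 4 * cheb_const * real (n div 6) + K"
        using False by (intro less) auto
      also have "5 / 4 * cheb_const * real (n div 6) \<le> 5 / 4 * cheb_const * (n / 6)"
        using cheb_const_pos of_nat_div_le_of_nat[of n 6, where 'a = real] by (intro mult_left_mono) auto
      also have "5 * (ln (real n) + 1) \<le> cheb_const / 24 * n"
        using False by (intro N) auto
      finally show ?thesis by (simp add: field_simps)
    qed
  qed
  then show ?thesis by blast
qed

section \<open>Proper prime powers and the existence of a prime\<close>

text \<open>Such a number is p ^ k with k \<ge> 2, hence p \<le> sqrt M, and 2 ^ k \<le> M bounds
  k.\<close>

lemma card_primepow_not_prime_le:
  fixes M :: nat
  assumes "M \<ge> 1"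
  shows "real (card {m\<in>{1..M}. primepow m \<and> \<not> prime m}) \<le> sqrt M * log 2 M"
proof -
  define P K where "P = nat \<lfloor>sqrt M\<rfloor>" and "K = nat \<lfloor>log 2 M\<rfloor>"
  have "{m\<in>{1..M}. primepow m \<and> \<not> prime m} \<subseteq> (\<lambda>(p, k). p ^ k) ` ({1..P} \<times> {1..K})"
  proof
    fix m assume m: "m \<in> {m\<in>{1..M}. primepow m \<and> \<not> prime m}"
    then obtain p k where pk: "prime p" "k > 0" "m = p ^ k"
      by (auto simp: primepow_def)
    with m have "k \<noteq> 1" by auto
    with pk have k: "k \<ge> 2" by simp
    have p: "p \<ge> 2" using pk(1) by (rule prime_ge_2_nat)
    have "p\<^sup>2 \<le> p ^ k" using k p by (intro power_increasing) auto
    also have "\<dots> \<le> M" using m pk by simp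
    finally have "real p \<le> sqrt M"
      by (intro real_le_rsqrt) (simp flip: of_nat_power)
    then have "p \<le> P" unfolding P_def by (simp add: le_nat_iff le_floor_iff)
    have "2 ^ k \<le> p ^ k" using p by (intro power_mono) auto
    also have "\<dots> \<le> M" using m pk by simp
    finally have "2 ^ k \<le> M" .
    then have "real (2 ^ k) \<le> real M"
      by (simp only: of_nat_le_iff)
    then have "real k \<le> log 2 M"
      by (intro le_log_of_power) simp_all
    then have "k \<le> K" unfolding K_def by (simp add: le_nat_iff le_floor_iff)
    with \<open>p \<le> P\<close> show "m \<in> (\<lambda>(p, k). p ^ k) ` ({1..P} \<times> {1..K})"
      using pk p by (intro image_eqI[of _ _ "(p, k)"]) auto
  qed
  then have "card {m\<in>{1..M}. primepow m \<and> \<not> prime m} \<le> card ({1..P} \<times> {1..K})"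
    by (rule surj_card_le[rotated]) simp
  also have "\<dots> = P * K" by simp
  finally have "real (card {m\<in>{1..M}. primepow m \<and> \<not> prime m}) \<le> real P * real K"
    by (simp flip: of_nat_mult)
  also have "\<dots> \<le> sqrt M * log 2 M"
    using assms by (intro mult_mono) (auto simp: P_def K_def)
  finally show ?thesis .
qed

text \<open>Without a prime in the interval, only proper prime powers contribute to the growth of
  \<open>psi\<close> there, which is of order at most sqrt n times a power of ln n. Chebyshev's
  bounds force linear growth instead.\<close>

lemma eventually_prime_between:
  "\<forall>\<^sub>F n in sequentially. \<exists>p. prime p \<and> n < p \<and> 3 * p \<le> 4 * n"
proof -
  obtain K where K: "\<And>n. psi n \<le> 5 / 4 * cheb_const * n + K"
    using psi_le by blast
  define c where "c = cheb_const"
  have c: "c > 0" using cheb_const_pos by (simp add: c_def)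
  \<comment> \<open>The right-hand side grows like c (4/3 - 5/4) n = c n / 12. The -1 pays for
    rounding 4n/3 down to \<open>M\<close>, and 2n is a crude upper bound for
    \<open>M\<close>.\<close>
  have "\<forall>\<^sub>F n::nat in sequentially. ln (2 * real n) * (sqrt (2 * real n) * log 2 (2 * real n))
      < c * (4 / 3 * n - 1) - 5 * (ln (2 * real n) + 1) - (5 / 4 * c * n + K)"
    using c by real_asymp
  moreover have "\<forall>\<^sub>F n::nat in sequentially. n \<ge> 30"
    by (rule eventually_ge_at_top)
  ultimately show ?thesis
  proof eventually_elim
    case (elim n)
    show ?case
    proof (rule ccontr)
      assume no: "\<nexists>p. prime p \<and> n < p \<and> 3 * p \<le> 4 * n"
      define M where "M = 4 * n div 3"
      have M: "n \<le> M" "30 \<le> M" "M \<le> 2 * n" using elim unfolding M_def by linarith+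
      have M': "4 / 3 * real n - 1 \<le> M" unfolding M_def by linarith
      define X where "X = {m\<in>{1..M}. primepow m \<and> \<not> prime m}"
      have nonprime: "\<not> prime m" if "n < m" "m \<le> M" for m
        using no that unfolding M_def by auto
      have "psi M = psi n + (\<Sum>m\<in>{n<..M}. mangoldt m)"
        unfolding psi_def using M
        by (subst sum.union_disjoint [symmetric]) (auto intro!: sum.cong)
      also have "(\<Sum>m\<in>{n<..M}. mangoldt m :: real) \<le> (\<Sum>m\<in>X. ln M)"
      proof -
        have "(\<Sum>m\<in>{n<..M}. mangoldt m :: real) = (\<Sum>m\<in>{n<..M} \<inter> X. mangoldt m)"
          by (rule sum.mono_neutral_right) (auto simp: X_def mangoldt_def dest: nonprime)
        also have "\<dots> \<le> (\<Sum>m\<in>X. mangoldt m)"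
          by (rule sum_mono2) (auto simp: X_def mangoldt_nonneg)
        also have "\<dots> \<le> (\<Sum>m\<in>X. ln M)"
        proof (rule sum_mono)
          fix m assume "m \<in> X"
          then show "mangoldt m \<le> ln (real M)"
            using mangoldt_le[of m] by (auto simp: X_def intro: order_trans)
        qed
        finally show ?thesis .
      qed
      also have "(\<Sum>m\<in>X. ln (real M)) = ln M * real (card X)"
        by simp
      also have "\<dots> \<le> ln M * (sqrt M * log 2 M)"
        unfolding X_def using M by (intro mult_left_mono card_primepow_not_prime_le) auto
      also have "\<dots> \<le> ln (2 * real n) * (sqrt (2 * real n) * log 2 (2 * real n))"
        using M by (intro mult_mono) auto
      finally have "psi M \<le> psi n + ln (2 * real n) * (sqrt (2 * real n) * log 2 (2 * real n))"
        by simp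
      moreover have "c * M - 5 * (ln M + 1) \<le> psi M"
        unfolding c_def using M by (intro psi_ge)
      moreover have "c * (4 / 3 * real n - 1) \<le> c * M"
        using c M' by (intro mult_left_mono) auto
      moreover have "ln (real M) \<le> ln (2 * real n)"
        using M by auto
      moreover have "psi n \<le> 5 / 4 * c * n + K"
        using K unfolding c_def by blast
      ultimately show False
        using elim by argo
    qed
  qed
qed

subsection \<open>Families of permutations from sort keys\<close>

lemma finite_perms: "finite (perms k)"
proof (rule finite_subset)
  show "perms k \<subseteq> {w. set w \<subseteq> {1..k} \<and> length w \<le> k}"
    by (auto simp: perms_def distinct_card[symmetric])
qed (rule finite_lists_length_le, simp)

text \<open>A member of \<open>W\<close> bounds the lengths of common subsequences, so
  \<open>Max\<close> is taken over a finite set, which contains 0 because of the empty word.\<close>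

lemma lcs_set_le:
  assumes "w \<in> W" "\<And>z. \<forall>w\<in>W. subseq z w \<Longrightarrow> length z \<le> L"
  shows "lcs_set W \<le> L"
proof -
  have "{length z |z. \<forall>w\<in>W. subseq z w} \<subseteq> {..length w}"
    using assms(1) by (auto dest: list_emb_length)
  then have "finite {length z |z. \<forall>w\<in>W. subseq z w}"
    by (rule finite_subset) simp
  moreover have "0 \<in> {length z |z. \<forall>w\<in>W. subseq z w}"
    by (auto intro: exI[of _ "[]"])
  ultimately show ?thesis
    unfolding lcs_set_def by (subst Max_le_iff) (use assms(2) in blast)+
qed

lemma lcsT_2_le:
  assumes "finite W" "card W \<ge> 2"
    and "\<And>u v z. u \<in> W \<Longrightarrow> v \<in> W \<Longrightarrow> u \<noteq> v \<Longrightarrow> subseq z u \<Longrightarrow> subseq z v \<Longrightarrow> length z \<le> L"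
  shows "lcsT 2 W \<le> L"
proof -
  let ?S = "{lcs_set W' | W'. W' \<subseteq> W \<and> card W' = 2}"
  have "finite ?S"
    using assms(1) by simp
  moreover obtain W' where "W' \<subseteq> W" "card W' = 2"
    using obtain_subset_with_card_n[OF assms(2)] by metis
  then have "?S \<noteq> {}" by blast
  moreover have "lcs_set W' \<le> L" if "W' \<subseteq> W" "card W' = 2" for W'
  proof -
    obtain u v where "W' = {u, v}" "u \<noteq> v"
      using \<open>card W' = 2\<close> by (auto simp: card_2_iff)
    then show ?thesis
      using that assms(3) by (intro lcs_set_le[of u]) auto
  qed
  ultimately show ?thesis
    unfolding lcsT_def by (subst Max_le_iff) auto
qed

lemma sorted_wrt_subseq: "subseq xs ys \<Longrightarrow> sorted_wrt P ys \<Longrightarrow> sorted_wrt P xs"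
proof (induction rule: list_emb.induct)
  case (list_emb_Cons2 x y xs ys)
  then show ?case
    by (auto dest: list_emb_set)
qed auto

lemma distinct_subseq: "subseq xs ys \<Longrightarrow> distinct ys \<Longrightarrow> distinct xs"
  by (induction rule: list_emb.induct) (auto dest: list_emb_set)

text \<open>The i-th permutation sorts the letters by \<open>key i\<close>. A common subsequence of
  two of them is weakly increasing in both keys, so its letters are pairwise comparable in the
  product order.\<close>

lemma lcsT_fam_2_perms_le:
  fixes key :: "nat \<Rightarrow> nat \<Rightarrow> 'b::linorder"
  assumes "2 \<le> t" "L < k"
    and chain: "\<And>i j A. i < t \<Longrightarrow> j < t \<Longrightarrow> i \<noteq> j \<Longrightarrow> A \<subseteq> {1..k} \<Longrightarrow>
      (\<And>u v. u \<in> A \<Longrightarrow> v \<in> A \<Longrightarrow>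
        (key i u \<le> key i v \<and> key j u \<le> key j v) \<or> (key i v \<le> key i u \<and> key j v \<le> key j u)) \<Longrightarrow>
      card A \<le> L"
  shows "lcsT_fam 2 t (perms k) \<le> L"
proof -
  define \<sigma> where "\<sigma> i = sort_key (key i) [1..<Suc k]" for i
  have \<sigma>: "distinct (\<sigma> i)" "set (\<sigma> i) = {1..k}" "length (\<sigma> i) = k" for i
    by (auto simp: \<sigma>_def)
  have sorted: "sorted_wrt (\<lambda>u v. key i u \<le> key i v) (\<sigma> i)" for i
    using sorted_sort_key[of "key i" "[1..<Suc k]"] unfolding \<sigma>_def sorted_map .
  have common: "length z \<le> L"
    if ij: "i < t" "j < t" "i \<noteq> j" and z: "subseq z (\<sigma> i)" "subseq z (\<sigma> j)" for i j z
  proof -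
    have "distinct z"
      using z(1) \<sigma>(1) by (rule distinct_subseq)
    have s: "sorted_wrt (\<lambda>u v. key i u \<le> key i v) z" "sorted_wrt (\<lambda>u v. key j u \<le> key j v) z"
      using z sorted sorted_wrt_subseq by blast+
    have "card (set z) \<le> L"
    proof (rule chain[OF ij])
      show "set z \<subseteq> {1..k}"
        using z(1) \<sigma>(2) by (auto dest: list_emb_set)
      fix u v assume "u \<in> set z" "v \<in> set z"
      then obtain a b where ab: "a < length z" "b < length z" "u = z ! a" "v = z ! b"
        by (auto simp: in_set_conv_nth)
      then show "(key i u \<le> key i v \<and> key j u \<le> key j v) \<or> (key i v \<le> key i u \<and> key j v \<le> key j u)"
        using s by (cases a b rule: linorder_cases) (auto simp: sorted_wrt_iff_nth_less)
    qed
    then show ?thesis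
      using \<open>distinct z\<close> by (simp add: distinct_card)
  qed
  \<comment> \<open>Two equal words would share a subsequence of length k > L, so the family really
    has t members.\<close>
  have "inj_on \<sigma> {..<t}"
  proof (rule inj_onI, rule ccontr)
    fix i j assume "i \<in> {..<t}" "j \<in> {..<t}" "\<sigma> i = \<sigma> j" "i \<noteq> j"
    then show False
      using common[of i j "\<sigma> i"] \<sigma>(3)[of i] \<open>L < k\<close> by simp
  qed
  then have card: "card (\<sigma> ` {..<t}) = t"
    by (simp add: card_image)
  have "\<sigma> ` {..<t} \<subseteq> perms k"
    using \<sigma> by (auto simp: perms_def)
  then have "lcsT_fam 2 t (perms k) \<le> lcsT 2 (\<sigma> ` {..<t})"
    unfolding lcsT_fam_def using card finite_perms
    by (intro Min_le) (auto intro!: finite_image_set)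
  also have "\<dots> \<le> L"
    using assms(1) card common by (intro lcsT_2_le) auto
  finally show ?thesis .
qed

subsection \<open>The orders along osculating planes\<close>

text \<open>Lexicographic order on pairs (a, b) with b a residue is encoded by the single integer p
  a + b; division recovers a.\<close>

lemma lex_rank_div:
  fixes a b p :: int
  assumes "0 \<le> b" "b < p"
  shows "(p * a + b) div p = a"
  using assms by simp

lemma lex_rank_eqD:
  fixes a b a' b' p :: int
  assumes "0 \<le> b" "b < p" "0 \<le> b'" "b' < p" "p * a + b = p * a' + b'"
  shows "a = a' \<and> b = b'"
  using lex_rank_div[of b p a] lex_rank_div[of b' p a'] assms by auto

lemma lex_rank_le:
  fixes a b a' b' p :: int
  assumes "0 \<le> b" "b < p" "0 \<le> b'" "b' < p" "p * a + b \<le> p * a' + b'"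
  shows "a \<le> a'"
  using lex_rank_div[of b p a] lex_rank_div[of b' p a'] zdiv_mono1[OF assms(5), of p] assms by auto

text \<open>
  The plane x + iy + i^2 z = const is parallel to the osculating plane of a twisted cubic;
  y + 2iz is the derivative of the left-hand side in i.
\<close>

definition tangent_rank :: "int \<Rightarrow> int \<Rightarrow> int \<times> int \<times> int \<Rightarrow> int" where
  "tangent_rank p i = (\<lambda>(x, y, z). p * ((x + i * y + i\<^sup>2 * z) mod p) + (y + 2 * i * z) mod p)"

text \<open>The weighted sum \<open>Q\<close> is injective on \<open>A\<close> and takes only 3p - 1
  possible values, all of them multiples of p.\<close>

lemma card_common_chain_le:
  fixes p i j :: int
  assumes p: "prime p" and ij: "\<not> p dvd i - j"
    and A: "A \<subseteq> {0..<p} \<times> {0..<p} \<times> {0..<p}"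
    and chain: "\<And>u v. u \<in> A \<Longrightarrow> v \<in> A \<Longrightarrow>
      (tangent_rank p i u \<le> tangent_rank p i v \<and> tangent_rank p j u \<le> tangent_rank p j v) \<or>
      (tangent_rank p i v \<le> tangent_rank p i u \<and> tangent_rank p j v \<le> tangent_rank p j u)"
  shows "int (card A) \<le> 3 * p - 1"
proof -
  have p1: "p > 1" using p by (simp add: prime_gt_1_int)
  define a :: "int \<Rightarrow> int \<times> int \<times> int \<Rightarrow> int" where "a = (\<lambda>i (x, y, z). (x + i * y + i\<^sup>2 * z) mod p)"
  define b :: "int \<Rightarrow> int \<times> int \<times> int \<Rightarrow> int" where "b = (\<lambda>i (x, y, z). (y + 2 * i * z) mod p)"
  have rank: "tangent_rank p i u = p * a i u + b i u" for i u
    by (simp add: tangent_rank_def a_def b_def split: prod.splits)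
  have rng: "0 \<le> a i u" "a i u < p" "0 \<le> b i u" "b i u < p" for i u
    using p1 by (auto simp: a_def b_def split: prod.splits)
  have "coprime (i - j) p"
    using p ij by (simp add: prime_imp_coprime coprime_commute)
  then obtain g where g: "[(i - j) * g = 1] (mod p)"
    using cong_solve_coprime_int by blast
  \<comment> \<open>\<open>h\<close> represents 2 / (i - j) modulo p. Its reduced form makes both
    weights p - h and h in \<open>Q\<close> nonnegative, hence \<open>Q\<close> monotone on chains;
    p - h replaces -h at the cost of a multiple of p.\<close>
  define h where "h = (2 * g) mod p"
  have h: "0 \<le> h" "h < p" using p1 by (auto simp: h_def)
  have hcong: "[h * (i - j) = 2] (mod p)"
  proof -
    have "[h * (i - j) = 2 * g * (i - j)] (mod p)"
      unfolding h_def by (intro cong_mult) auto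
    also have "2 * g * (i - j) = 2 * ((i - j) * g)" by simp
    also have "[2 * ((i - j) * g) = 2 * 1] (mod p)"
      using g by (intro cong_mult) auto
    finally show ?thesis by simp
  qed
  define Q where "Q u = tangent_rank p i u + tangent_rank p j u + (p - h) * a i u + h * a j u" for u
  have dvd: "p dvd Q u" for u
  proof -
    obtain x y z where u: "u = (x, y, z)" by (cases u)
    have ac: "[a i u = x + i * y + i\<^sup>2 * z] (mod p)" and bc: "[b i u = y + 2 * i * z] (mod p)" for i
      by (auto simp: a_def b_def u)
    \<comment> \<open>Modulo p, the difference of the first residues is (i - j) w and the sum of the
      second residues is 2w.\<close>
    define w where "w = y + (i + j) * z"
    have "Q u = p * (2 * a i u + a j u) + (b i u + b j u - h * (a i u - a j u))"
      by (simp add: Q_def rank algebra_simps)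
    then have "[Q u = b i u + b j u - h * (a i u - a j u)] (mod p)"
      by (simp add: cong_def)
    also have "[b i u + b j u - h * (a i u - a j u) = (y + 2 * i * z) + (y + 2 * j * z)
        - h * ((x + i * y + i\<^sup>2 * z) - (x + j * y + j\<^sup>2 * z))] (mod p)"
      by (intro cong_add cong_mult cong_diff cong_refl ac bc)
    also have "(y + 2 * i * z) + (y + 2 * j * z) - h * ((x + i * y + i\<^sup>2 * z) - (x + j * y + j\<^sup>2 * z))
        = 2 * w - h * (i - j) * w"
      by (simp add: w_def algebra_simps power2_eq_square)
    also have "[2 * w - h * (i - j) * w = 2 * w - 2 * w] (mod p)"
      by (intro cong_diff cong_mult cong_refl hcong)
    finally show ?thesis by (simp add: cong_0_iff)
  qed
  have range: "Q u \<in> (\<lambda>m. p * m) ` {0..3 * p - 2}" for u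
  proof -
    obtain m where m: "Q u = p * m" using dvd by blast
    have "Q u = (2 * p - h) * a i u + (p + h) * a j u + b i u + b j u"
      by (simp add: Q_def rank algebra_simps)
    moreover have "(2 * p - h) * a i u \<le> (2 * p - h) * (p - 1)"
      using h rng(2)[of i u] by (intro mult_left_mono) auto
    moreover have "(p + h) * a j u \<le> (p + h) * (p - 1)"
      using h rng(2)[of j u] by (intro mult_left_mono) auto
    moreover have "0 \<le> (2 * p - h) * a i u" "0 \<le> (p + h) * a j u"
      using h rng by auto
    ultimately have "0 \<le> Q u" "Q u \<le> (2 * p - h) * (p - 1) + (p + h) * (p - 1) + (p - 1) + (p - 1)"
      using rng[of i u] rng[of j u] by linarith+
    \<comment> \<open>The terms in h cancel: the left-hand side is (3p + 2)(p - 1) = p (3p - 1) -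
      2.\<close>
    moreover have "(2 * p - h) * (p - 1) + (p + h) * (p - 1) + (p - 1) + (p - 1) < p * (3 * p - 1)"
      using p1 by (simp add: algebra_simps)
    ultimately have "0 \<le> p * m" "p * m < p * (3 * p - 1)"
      using m by linarith+
    then have "0 \<le> m" "m < 3 * p - 1"
      using p1 by (simp_all add: zero_le_mult_iff)
    with m show ?thesis by auto
  qed
  have eq: "u = v"
    if uv: "u \<in> A" "v \<in> A" "Q u = Q v"
      and le: "tangent_rank p i u \<le> tangent_rank p i v" "tangent_rank p j u \<le> tangent_rank p j v"
    for u v
  proof -
    have a_le: "a i u \<le> a i v" "a j u \<le> a j v"
      using le rng lex_rank_le unfolding rank by metis+
    have "(p - h) * a i u \<le> (p - h) * a i v" "h * a j u \<le> h * a j v"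
      using h a_le by (auto intro: mult_left_mono)
    \<comment> \<open>Each of the four summands of \<open>Q\<close> is weakly larger at v, so
      equality of the sums forces equality of the ranks.\<close>
    then have r: "tangent_rank p i u = tangent_rank p i v" "tangent_rank p j u = tangent_rank p j v"
      using le uv(3) unfolding Q_def by linarith+
    then have ab: "a i u = a i v" "b i u = b i v" "a j u = a j v"
      using lex_rank_eqD rng unfolding rank by metis+
    obtain x y z x' y' z' where c: "u = (x, y, z)" "v = (x', y', z')"
      by (cases u, cases v) auto
    have "p dvd (x - x') + i * (y - y') + i\<^sup>2 * (z - z')" "p dvd (y - y') + 2 * i * (z - z')"
        "p dvd (x - x') + j * (y - y') + j\<^sup>2 * (z - z')"
      using ab by (auto simp: a_def b_def c mod_eq_dvd_iff algebra_simps)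
    note d = this
    \<comment> \<open>The difference of the two plane equations is divisible by i - j. Subtracting
      the quotient from the equation of \<open>b i\<close> leaves (i - j)(z - z'), so z, then y,
      then x is determined.\<close>
    have "p dvd (i - j) * ((y - y') + (i + j) * (z - z'))"
      using dvd_diff[OF d(1,3)] by (simp add: algebra_simps power2_eq_square)
    then have d4: "p dvd (y - y') + (i + j) * (z - z')"
      using p ij by (simp add: prime_dvd_mult_iff)
    have "p dvd (i - j) * (z - z')"
      using dvd_diff[OF d(2) d4] by (simp add: algebra_simps)
    then have dz: "p dvd z - z'"
      using p ij by (simp add: prime_dvd_mult_iff)
    have eqI: "s = t" if "p dvd s - t" "s \<in> {0..<p}" "t \<in> {0..<p}" for s t
      using that by (metis atLeastLessThan_iff mod_eq_dvd_iff mod_pos_pos_trivial)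
    have mem: "x \<in> {0..<p}" "y \<in> {0..<p}" "z \<in> {0..<p}" "x' \<in> {0..<p}" "y' \<in> {0..<p}" "z' \<in> {0..<p}"
      using uv A by (auto simp: c)
    have "z = z'" using dz mem by (intro eqI)
    moreover have "y = y'" using d(2) mem \<open>z = z'\<close> by (intro eqI) auto
    moreover have "x = x'" using d(1) mem \<open>z = z'\<close> \<open>y = y'\<close> by (intro eqI) auto
    ultimately show ?thesis by (simp add: c)
  qed
  have "inj_on Q A"
  proof (rule inj_onI)
    fix u v assume "u \<in> A" "v \<in> A" "Q u = Q v"
    then show "u = v"
      using chain[of u v] eq[of u v] eq[of v u] by auto
  qed
  then have "card A = card (Q ` A)" by (simp add: card_image)
  also have "\<dots> \<le> card ((\<lambda>m. p * m) ` {0..3 * p - 2})"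
    using range by (intro card_mono) auto
  also have "\<dots> \<le> card {0..3 * p - 2}"
    by (rule card_image_le) simp
  finally show ?thesis using p1 by simp
qed

section \<open>Passage from primes to all t and k\<close>

text \<open>The letters embed into the p ^ 3 points of the cube, and indices below t \<le> p are
  pairwise incongruent. The condition 3p \<le> k keeps the bound below k, as distinctness of the
  words demands.\<close>

lemma lcsT_fam_2_perms_le_prime:
  assumes p: "prime p" and "2 \<le> t" "t \<le> p" "k \<le> p ^ 3" "3 * p \<le> k"
  shows "lcsT_fam 2 t (perms k) \<le> 3 * p - 1"
proof -
  let ?G = "{0..<int p} \<times> {0..<int p} \<times> {0..<int p}"
  have "card {1..k} \<le> card ?G"
    using assms by (simp add: card_cartesian_product power3_eq_cube mult.assoc)
  then obtain f where f: "f ` {1..k} \<subseteq> ?G" "inj_on f {1..k}"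
    using card_le_inj[of "{1..k}" ?G] by auto
  show ?thesis
  proof (rule lcsT_fam_2_perms_le[where key = "\<lambda>i u. tangent_rank p i (f u)"])
    show "3 * p - 1 < k" using assms prime_gt_0_nat[OF p] by simp
    fix i j A
    assume i: "i < t" "j < t" "i \<noteq> j" and A: "A \<subseteq> {1..k}"
      and chain: "\<And>u v. u \<in> A \<Longrightarrow> v \<in> A \<Longrightarrow>
        (tangent_rank p i (f u) \<le> tangent_rank p i (f v) \<and> tangent_rank p j (f u) \<le> tangent_rank p j (f v)) \<or>
        (tangent_rank p i (f v) \<le> tangent_rank p i (f u) \<and> tangent_rank p j (f v) \<le> tangent_rank p j (f u))"
    have "\<not> int p dvd int i - int j"
      using i assms zdvd_not_zless[of "\<bar>int i - int j\<bar>" "int p"] by auto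
    moreover have "f ` A \<subseteq> ?G"
      using A f(1) by blast
    ultimately have "int (card (f ` A)) \<le> 3 * int p - 1"
    proof (intro card_common_chain_le[of "int p" "int i" "int j"])
      fix u v assume "u \<in> f ` A" "v \<in> f ` A"
      then show "(tangent_rank p i u \<le> tangent_rank p i v \<and> tangent_rank p j u \<le> tangent_rank p j v) \<or>
        (tangent_rank p i v \<le> tangent_rank p i u \<and> tangent_rank p j v \<le> tangent_rank p j u)"
        using chain by blast
    qed (use p in simp)
    then show "card A \<le> 3 * p - 1"
      using A f(2) by (simp add: card_image inj_on_subset)
  qed fact
qed

text \<open>The trivial bound, for the cases out of reach of the prime construction. A family of t
  permutations exists since t \<le> k \<le> k!.\<close>

lemma lcsT_fam_2_perms_le_length:
  assumes "2 \<le> t" "t \<le> k"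
  shows "lcsT_fam 2 t (perms k) \<le> k"
proof -
  have "perms k = permutations_of_set {1..k}"
    by (auto simp: perms_def permutations_of_set_def)
  then have "t \<le> card (perms k)"
    using assms fact_ge_self[of k] by simp
  then obtain W where W: "W \<subseteq> perms k" "card W = t"
    using obtain_subset_with_card_n by metis
  then have "lcsT_fam 2 t (perms k) \<le> lcsT 2 W"
    unfolding lcsT_fam_def using finite_perms
    by (intro Min_le) (auto intro!: finite_image_set)
  also have "\<dots> \<le> k"
  proof (rule lcsT_2_le)
    fix u z assume "u \<in> W" "subseq z u"
    then show "length z \<le> k"
      using W(1) by (auto simp: perms_def distinct_card [symmetric] dest!: list_emb_length)
  qed (use W assms finite_perms finite_subset in auto)
  finally show ?thesis .
qed

text \<open>For large n with 4n \<le> k, a prime p with n < p \<le> 4n/3 gives 3p - 1 < 4n.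
  Otherwise k < 4n or k \<le> N ^ 3, and the trivial bound suffices with the constant N ^ 3.\<close>

lemma lcsT_fam_2_perms_le_linear:
  "\<exists>C. \<forall>n t k. 2 \<le> t \<and> t \<le> n \<and> t \<le> k \<and> k \<le> n ^ 3 \<longrightarrow> lcsT_fam 2 t (perms k) \<le> 4 * n + C"
proof -
  obtain N :: nat where N: "\<And>n. n \<ge> N \<Longrightarrow> \<exists>p. prime p \<and> n < p \<and> 3 * p \<le> 4 * n"
    using eventually_prime_between by (auto simp: eventually_at_top_linorder)
  have "lcsT_fam 2 t (perms k) \<le> 4 * n + N ^ 3"
    if t: "2 \<le> t" "t \<le> n" "t \<le> k" and k: "k \<le> n ^ 3" for n t k
  proof (cases "N \<le> n \<and> 4 * n \<le> k")
    case True
    then obtain p where p: "prime p" "n < p" "3 * p \<le> 4 * n"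
      using N by blast
    have "n ^ 3 \<le> p ^ 3"
      using p by (intro power_mono) auto
    then have "lcsT_fam 2 t (perms k) \<le> 3 * p - 1"
      using t k p True by (intro lcsT_fam_2_perms_le_prime order_trans[OF k]) auto
    then show ?thesis
      using p by linarith
  next
    case False
    have "k \<le> 4 * n + N ^ 3"
    proof (cases "N \<le> n")
      case True
      with False show ?thesis by simp
    next
      case False
      then have "n ^ 3 \<le> N ^ 3" by (intro power_mono) auto
      with k show ?thesis by linarith
    qed
    then show ?thesis
      using lcsT_fam_2_perms_le_length[OF t(1,3)] by simp
  qed
  then show ?thesis by blast
qed

theorem theorem6:
  shows "\<exists>C::real. \<forall>t k :: nat.
    3 \<le> t \<and> real t \<le> sqrt (real k) \<longrightarrow>
      (real t \<le> real k powr (1/3) \<longrightarrow>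
         real (lcsT_fam 2 t (perms k)) \<le> 4 * real k powr (1/3) + C * real k powr (7/40)) \<and>
      (real k powr (1/3) \<le> real t \<longrightarrow>
         real (lcsT_fam 2 t (perms k)) \<le> 4 * real t + C * real t powr (21/40))"
proof -
  obtain C where C: "\<And>n t k. 2 \<le> t \<Longrightarrow> t \<le> n \<Longrightarrow> t \<le> k \<Longrightarrow> k \<le> n ^ 3 \<Longrightarrow>
      lcsT_fam 2 t (perms k) \<le> 4 * n + C"
    using lcsT_fam_2_perms_le_linear by blast
  show ?thesis
  \<comment> \<open>The extra 4 pays for rounding the cube root of k up to an integer n in the term
    4n.\<close>
  proof (intro exI[of _ "real C + 4"] allI impI, elim conjE)
    fix t k :: nat
    assume t: "3 \<le> t" and "real t \<le> sqrt (real k)"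
    then have "(real t)\<^sup>2 \<le> (sqrt (real k))\<^sup>2"
      by (intro power_mono) auto
    then have "t\<^sup>2 \<le> k"
      by (simp flip: of_nat_power)
    then have tk: "t \<le> k"
      using self_le_power[of t 2] t by linarith
    define r where "r = real k powr (1/3)"
    have k1: "1 \<le> real k" using t tk by simp
    then have "r ^ 3 = real k powr (1/3 * real 3)"
      unfolding r_def by (subst powr_power) auto
    with k1 have r3: "r ^ 3 = real k" by simp
    have r0: "0 \<le> r" by (simp add: r_def)
    have k_le: "k \<le> n ^ 3" if "r \<le> real n" for n :: nat
    proof -
      have "r ^ 3 \<le> real n ^ 3"
        using that r0 by (intro power_mono)
      then show ?thesis
        unfolding r3 by (simp flip: of_nat_power)
    qed
    \<comment> \<open>The error obtained is constant, so of the powers in the claim only the bound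
      \<ge> 1 is used.\<close>
    have err: "real C + 4 \<le> (real C + 4) * x powr e" if "1 \<le> x" "0 \<le> e" for x e :: real
      using mult_left_mono[OF ge_one_powr_ge_zero[OF that], of "real C + 4"] by simp
    show "(real t \<le> real k powr (1/3) \<longrightarrow>
         real (lcsT_fam 2 t (perms k)) \<le> 4 * real k powr (1/3) + (real C + 4) * real k powr (7/40)) \<and>
      (real k powr (1/3) \<le> real t \<longrightarrow>
         real (lcsT_fam 2 t (perms k)) \<le> 4 * real t + (real C + 4) * real t powr (21/40))"
      unfolding r_def [symmetric]
    proof (intro conjI impI)
      assume tr: "real t \<le> r"
      define n where "n = nat \<lceil>r\<rceil>"
      have n: "r \<le> real n" "real n \<le> r + 1"
        using r0 unfolding n_def by linarith+
      then have "lcsT_fam 2 t (perms k) \<le> 4 * n + C"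
        using t tk tr by (intro C k_le) auto
      then have "real (lcsT_fam 2 t (perms k)) \<le> real (4 * n + C)"
        by (simp only: of_nat_le_iff)
      then have "real (lcsT_fam 2 t (perms k)) \<le> 4 * r + (real C + 4)"
        using n by simp
      then show "real (lcsT_fam 2 t (perms k)) \<le> 4 * r + (real C + 4) * real k powr (7/40)"
        using err[of "real k" "7/40"] k1 by linarith
    next
      assume "r \<le> real t"
      \<comment> \<open>In this range t itself serves as n, without rounding.\<close>
      then have "lcsT_fam 2 t (perms k) \<le> 4 * t + C"
        using t tk by (intro C k_le) auto
      then have "real (lcsT_fam 2 t (perms k)) \<le> real (4 * t + C)"
        by (simp only: of_nat_le_iff)
      then show "real (lcsT_fam 2 t (perms k)) \<le> 4 * real t + (real C + 4) * real t powr (21/40)"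
        using err[of "real t" "21/40"] t by linarith
    qed
  qed
qed

end
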